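(* Let $\lambda\in(0,\infty]$ be given. Then the functor $\mathfrak{D}_\lambda:\mathbf{Tych}\to\mathbf{ExtMetTop}_{\le\lambda}$ is fully faithful and injective on objects. Moreover, $\mathfrak{D}_\lambda$ is the left adjoint to the forgetful functor $U_\lambda:\mathbf{ExtMetTop}_{\le\lambda}\to\mathbf{Tych}$, $(X,\tau,d)\mapsto(X,\tau)$. In particular, $\mathfrak{D}_\lambda$ exhibits $\mathbf{Tych}$ as a coreflective subcategory of $\mathbf{ExtMetTop}_{\le\lambda}$.
   Context: An extended distance on a set $X$ is a function $d:X\times X\to[0,+\infty]$ that is symmetric, satisfies the triangle inequality, and is such that $d(x,y)=0$ if and only if $x=y$. For a topology $\tau$ and an extended distance $d$ on $X$, $\mathrm{LIP}_{b,1}(X,\tau,d)$ is the set of bounded $\tau$-continuous $f:X\to\mathbb{R}$ with $|f(x)-f(y)|\le d(x,y)$ for all $x,y$. $(X,\tau,d)$ is an e.m.t. space if $\tau$ is the initial topology of $\mathrm{LIP}_{b,1}(X,\tau,d)$ and $d(x,y)=\sup\{|f(x)-f(y)|:f\in\mathrm{LIP}_{b,1}(X,\tau,d)\}$ for all $x,y$; in that case $(X,\tau)$ is a Tychonoff (completely regular Hausdorff) space. A continuous-short map is a map that is continuous for the topologies and non-expansive for the extended distances. $\mathbf{ExtMetTop}$ is the category of e.m.t. spaces and continuous-short maps. For $\lambda<\infty$, $\mathbf{ExtMetTop}_{\le\lambda}$ is the full subcategory of $\mathbf{ExtMetTop}$ of those e.m.t. spaces with $d(x,y)\le\lambda$ for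 all $x,y$; for $\lambda=\infty$, $\mathbf{ExtMetTop}_{\le\infty}=\mathbf{ExtMetTop}$. $\mathbf{Tych}$ is the category of Tychonoff spaces and continuous maps. The $\lambda$-discrete distance on a set $X$ is $d^X_{\lambda\text{-discr}}(x,y)=0$ if $x=y$ and $=\lambda$ if $x\ne y$. The $\lambda$-discretisation functor $\mathfrak{D}_\lambda$ sends a Tychonoff space $(X,\tau)$ to the e.m.t. space $(X,\tau,d^X_{\lambda\text{-discr}})$ and a continuous map $\varphi$ to the same map $\varphi$. A fully faithful functor $G:\mathbf{B}\to\mathbf{A}$ having a right adjoint $F$ is said to exhibit $\mathbf{B}$ as a coreflective subcategory of $\mathbf{A}$, with coreflector $F$. *)

theory Defs
  imports "HOL-Analysis.Analysis"
begin

text \<open>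
  A category is given by its objects and its hom-sets. A bare morphism does not determine its
  domain and codomain (the hom-sets need not be disjoint), so composition and the action of a
  functor on morphisms take the objects involved as arguments:
  for \<open>f \<in> Hom C X Y\<close> and \<open>g \<in> Hom C Y Z\<close> the composite of \<open>g\<close> after \<open>f\<close> is \<open>Comp C X Y Z g f\<close>.
\<close>

record ('o, 'm) cat =
  Obj :: "'o set"
  Hom :: "'o \<Rightarrow> 'o \<Rightarrow> 'm set"
  Id :: "'o \<Rightarrow> 'm"
  Comp :: "'o \<Rightarrow> 'o \<Rightarrow> 'o \<Rightarrow> 'm \<Rightarrow> 'm \<Rightarrow> 'm"

locale category =
  fixes C :: "('o, 'm) cat"
  assumes Id_in_Hom: "X \<in> Obj C \<Longrightarrow> Id C X \<in> Hom C X X"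
    and Comp_in_Hom: "\<lbrakk>X \<in> Obj C; Y \<in> Obj C; Z \<in> Obj C; f \<in> Hom C X Y; g \<in> Hom C Y Z\<rbrakk>
      \<Longrightarrow> Comp C X Y Z g f \<in> Hom C X Z"
    and Comp_Id_right: "\<lbrakk>X \<in> Obj C; Y \<in> Obj C; f \<in> Hom C X Y\<rbrakk>
      \<Longrightarrow> Comp C X X Y f (Id C X) = f"
    and Comp_Id_left: "\<lbrakk>X \<in> Obj C; Y \<in> Obj C; f \<in> Hom C X Y\<rbrakk>
      \<Longrightarrow> Comp C X Y Y (Id C Y) f = f"
    and Comp_assoc: "\<lbrakk>W \<in> Obj C; X \<in> Obj C; Y \<in> Obj C; Z \<in> Obj C;
        f \<in> Hom C W X; g \<in> Hom C X Y; h \<in> Hom C Y Z\<rbrakk>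
      \<Longrightarrow> Comp C W Y Z h (Comp C W X Y g f) = Comp C W X Z (Comp C X Y Z h g) f"

definition full_subcategory :: "('o, 'm) cat \<Rightarrow> ('o \<Rightarrow> bool) \<Rightarrow> ('o, 'm) cat" where
  "full_subcategory C P = C\<lparr>Obj := {X \<in> Obj C. P X}\<rparr>"

record ('o1, 'm1, 'o2, 'm2) func =
  omap :: "'o1 \<Rightarrow> 'o2"
  amap :: "'o1 \<Rightarrow> 'o1 \<Rightarrow> 'm1 \<Rightarrow> 'm2"

locale is_functor = A: category A + B: category B
  for A :: "('o1, 'm1) cat" and B :: "('o2, 'm2) cat" +
  fixes F :: "('o1, 'm1, 'o2, 'm2) func"
  assumes omap_in_Obj: "X \<in> Obj A \<Longrightarrow> omap F X \<in> Obj B"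
    and amap_in_Hom: "\<lbrakk>X \<in> Obj A; Y \<in> Obj A; f \<in> Hom A X Y\<rbrakk>
      \<Longrightarrow> amap F X Y f \<in> Hom B (omap F X) (omap F Y)"
    and amap_Id: "X \<in> Obj A \<Longrightarrow> amap F X X (Id A X) = Id B (omap F X)"
    and amap_Comp: "\<lbrakk>X \<in> Obj A; Y \<in> Obj A; Z \<in> Obj A; f \<in> Hom A X Y; g \<in> Hom A Y Z\<rbrakk>
      \<Longrightarrow> amap F X Z (Comp A X Y Z g f)
        = Comp B (omap F X) (omap F Y) (omap F Z) (amap F Y Z g) (amap F X Y f)"

definition fully_faithful ::
    "('o1, 'm1) cat \<Rightarrow> ('o2, 'm2) cat \<Rightarrow> ('o1, 'm1, 'o2, 'm2) func \<Rightarrow> bool" where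
  "fully_faithful A B F \<longleftrightarrow> is_functor A B F \<and>
    (\<forall>X\<in>Obj A. \<forall>Y\<in>Obj A. bij_betw (amap F X Y) (Hom A X Y) (Hom B (omap F X) (omap F Y)))"

definition injective_on_objects ::
    "('o1, 'm1) cat \<Rightarrow> ('o1, 'm1, 'o2, 'm2) func \<Rightarrow> bool" where
  "injective_on_objects A F \<longleftrightarrow> inj_on (omap F) (Obj A)"

text \<open>
  \<open>F : A \<rightarrow> B\<close> is left adjoint to \<open>G : B \<rightarrow> A\<close>: there are bijections
  \<open>\<Phi> X Y : Hom B (F X) Y \<rightarrow> Hom A X (G Y)\<close>, natural in \<open>X\<close> and \<open>Y\<close>, i.e.
  \<open>\<Phi> (k \<circ> h \<circ> F f) = G k \<circ> \<Phi> h \<circ> f\<close> for \<open>f : X' \<rightarrow> X\<close>, \<open>h : F X \<rightarrow> Y\<close>, \<open>k : Y \<rightarrow> Y'\<close>.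
\<close>

definition left_adjoint ::
    "('o1, 'm1) cat \<Rightarrow> ('o2, 'm2) cat \<Rightarrow> ('o1, 'm1, 'o2, 'm2) func \<Rightarrow> ('o2, 'm2, 'o1, 'm1) func
      \<Rightarrow> bool" where
  "left_adjoint A B F G \<longleftrightarrow> is_functor A B F \<and> is_functor B A G \<and>
    (\<exists>\<Phi>. (\<forall>X\<in>Obj A. \<forall>Y\<in>Obj B. bij_betw (\<Phi> X Y) (Hom B (omap F X) Y) (Hom A X (omap G Y))) \<and>
         (\<forall>X\<in>Obj A. \<forall>X'\<in>Obj A. \<forall>Y\<in>Obj B. \<forall>Y'\<in>Obj B.
           \<forall>f\<in>Hom A X' X. \<forall>h\<in>Hom B (omap F X) Y. \<forall>k\<in>Hom B Y Y'.
             \<Phi> X' Y' (Comp B (omap F X') Y Y' k (Comp B (omap F X') (omap F X) Y h (amap F X' X f)))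
             = Comp A X' (omap G Y) (omap G Y') (amap G Y Y' k)
                 (Comp A X' X (omap G Y) (\<Phi> X Y h) f)))"

definition exhibits_coreflective ::
    "('o1, 'm1) cat \<Rightarrow> ('o2, 'm2) cat \<Rightarrow> ('o1, 'm1, 'o2, 'm2) func \<Rightarrow> ('o2, 'm2, 'o1, 'm1) func
      \<Rightarrow> bool" where
  "exhibits_coreflective B A G F \<longleftrightarrow> fully_faithful B A G \<and> left_adjoint B A G F"

text \<open>
  The carrier of a space is the \<open>topspace\<close> of its topology, an arbitrary subset of the type \<open>'a\<close>.
  Distances and maps are extensional (\<open>undefined\<close> off their domain), so that HOL equality is
  equality of functions on the carriers. The type \<open>'a\<close> plays the role of the universe: the
  categories below consist of all spaces whose carrier is a subset of \<open>'a\<close>.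
\<close>

definition extended_distance :: "'a set \<Rightarrow> ('a \<times> 'a \<Rightarrow> ennreal) \<Rightarrow> bool" where
  "extended_distance X d \<longleftrightarrow> d \<in> extensional (X \<times> X) \<and>
    (\<forall>x\<in>X. \<forall>y\<in>X. d (x, y) = d (y, x)) \<and>
    (\<forall>x\<in>X. \<forall>y\<in>X. \<forall>z\<in>X. d (x, z) \<le> d (x, y) + d (y, z)) \<and>
    (\<forall>x\<in>X. \<forall>y\<in>X. d (x, y) = 0 \<longleftrightarrow> x = y)"

definition LIPb1 :: "'a topology \<Rightarrow> ('a \<times> 'a \<Rightarrow> ennreal) \<Rightarrow> ('a \<Rightarrow> real) set" where
  "LIPb1 \<tau> d = {f \<in> extensional (topspace \<tau>).
     bounded (f ` topspace \<tau>) \<and> continuous_map \<tau> euclideanreal f \<and>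
     (\<forall>x\<in>topspace \<tau>. \<forall>y\<in>topspace \<tau>. ennreal \<bar>f x - f y\<bar> \<le> d (x, y))}"

text \<open>
  The initial topology on \<open>X\<close> of a family of real functions. The underlying set of the generated
  topology is the union of the generating sets, which is \<open>X\<close> as soon as the family is nonempty
  (\<open>LIPb1 \<tau> d\<close> always contains the zero function).
\<close>

definition initial_topology :: "'a set \<Rightarrow> ('a \<Rightarrow> real) set \<Rightarrow> 'a topology" where
  "initial_topology X \<F> = topology_generated_by {f -` U \<inter> X | f U. f \<in> \<F> \<and> open U}"

definition emt_space :: "'a topology \<Rightarrow> ('a \<times> 'a \<Rightarrow> ennreal) \<Rightarrow> bool" where
  "emt_space \<tau> d \<longleftrightarrow> extended_distance (topspace \<tau>) d \<and>
    \<tau> = initial_topology (topspace \<tau>) (LIPb1 \<tau> d) \<and>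
    (\<forall>x\<in>topspace \<tau>. \<forall>y\<in>topspace \<tau>. d (x, y) = (SUP f\<in>LIPb1 \<tau> d. ennreal \<bar>f x - f y\<bar>))"

type_synonym 'a emt = "'a topology \<times> ('a \<times> 'a \<Rightarrow> ennreal)"

definition tychonoff_space :: "'a topology \<Rightarrow> bool" where
  "tychonoff_space \<tau> \<longleftrightarrow> completely_regular_space \<tau> \<and> Hausdorff_space \<tau>"

definition Tych :: "('a topology, 'a \<Rightarrow> 'a) cat" where
  "Tych = \<lparr>Obj = {\<tau>. tychonoff_space \<tau>},
     Hom = (\<lambda>\<tau> \<tau>'. {f \<in> extensional (topspace \<tau>). continuous_map \<tau> \<tau>' f}),
     Id = (\<lambda>\<tau>. \<lambda>x\<in>topspace \<tau>. x),
     Comp = (\<lambda>\<tau> \<tau>' \<tau>'' g f. compose (topspace \<tau>) g f)\<rparr>"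

definition continuous_short_map :: "'a emt \<Rightarrow> 'b emt \<Rightarrow> ('a \<Rightarrow> 'b) \<Rightarrow> bool" where
  "continuous_short_map = (\<lambda>(\<tau>, d) (\<tau>', d') f. continuous_map \<tau> \<tau>' f \<and>
     (\<forall>x\<in>topspace \<tau>. \<forall>y\<in>topspace \<tau>. d' (f x, f y) \<le> d (x, y)))"

definition ExtMetTop :: "('a emt, 'a \<Rightarrow> 'a) cat" where
  "ExtMetTop = \<lparr>Obj = {(\<tau>, d). emt_space \<tau> d},
     Hom = (\<lambda>S T. {f \<in> extensional (topspace (fst S)). continuous_short_map S T f}),
     Id = (\<lambda>S. \<lambda>x\<in>topspace (fst S). x),
     Comp = (\<lambda>S T R g f. compose (topspace (fst S)) g f)\<rparr>"

definition ExtMetTop_le :: "ennreal \<Rightarrow> ('a emt, 'a \<Rightarrow> 'a) cat" where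
  "ExtMetTop_le l = (if l = \<infinity> then ExtMetTop else
     full_subcategory ExtMetTop
       (\<lambda>(\<tau>, d). \<forall>x\<in>topspace \<tau>. \<forall>y\<in>topspace \<tau>. d (x, y) \<le> l))"

definition discrete_distance :: "ennreal \<Rightarrow> 'a set \<Rightarrow> 'a \<times> 'a \<Rightarrow> ennreal" where
  "discrete_distance l X = (\<lambda>(x, y)\<in>X \<times> X. if x = y then 0 else l)"

definition discretisation :: "ennreal \<Rightarrow> ('a topology, 'a \<Rightarrow> 'a, 'a emt, 'a \<Rightarrow> 'a) func" where
  "discretisation l = \<lparr>omap = (\<lambda>\<tau>. (\<tau>, discrete_distance l (topspace \<tau>))),
     amap = (\<lambda>\<tau> \<tau>' f. f)\<rparr>"

text \<open>The data of the forgetful functor are the same for every bound on the distances.\<close>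

definition forgetful :: "('a emt, 'a \<Rightarrow> 'a, 'a topology, 'a \<Rightarrow> 'a) func" where
  "forgetful = \<lparr>omap = (\<lambda>(\<tau>, d). \<tau>), amap = (\<lambda>S T f. f)\<rparr>"

end

theory Submission
  imports Defs
begin

text \<open>
  The discrete distance makes every continuous map short, so for a Tychonoff space
  \<open>X\<close> and a space \<open>Y\<close> in \<open>ExtMetTop_le l\<close> the morphisms \<open>discretisation l X \<rightarrow> Y\<close> are exactly the
  continuous maps from \<open>X\<close> to the underlying space of \<open>Y\<close>; full faithfulness and the adjunction
  are both instances of this equality of hom-sets. That the discretisation is an e.m.t. space
  follows by scaling the separating functions of complete regularity: a function with values in
  \<open>[0, c]\<close>, \<open>c \<le> l\<close>, is short for the discrete distance.
\<close>

subsection \<open>Initial topologies\<close>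

text \<open>Continuity makes every subbasic set open. Conversely, \<open>sep\<close> exhibits each
  open set as a union of single preimages, so finite intersections never enter.\<close>

lemma initial_topology_eqI:
  assumes cont: "\<And>f. f \<in> \<F> \<Longrightarrow> continuous_map \<tau> euclideanreal f"
    and sep: "\<And>U x. \<lbrakk>openin \<tau> U; x \<in> U\<rbrakk> \<Longrightarrow>
      \<exists>f\<in>\<F>. \<exists>V. open V \<and> f x \<in> V \<and> f -` V \<inter> topspace \<tau> \<subseteq> U"
  shows "initial_topology (topspace \<tau>) \<F> = \<tau>"
proof -
  let ?B = "{f -` V \<inter> topspace \<tau> | f V. f \<in> \<F> \<and> open V}"
  have B: "openin \<tau> S" if "S \<in> ?B" for S
    using that openin_continuous_map_preimage[OF cont]
    by (auto simp: vimage_def Int_def conj_commute)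
  have "generate_topology_on ?B U \<longleftrightarrow> openin \<tau> U" for U
  proof
    assume "generate_topology_on ?B U"
    then show "openin \<tau> U"
      using generate_topology_on_coarsest[of "openin \<tau>" ?B] B istopology_openin by blast
  next
    assume U: "openin \<tau> U"
    have "U = \<Union>{S \<in> ?B. S \<subseteq> U}"
    proof (intro subset_antisym subsetI)
      fix x assume x: "x \<in> U"
      obtain f V where "f \<in> \<F>" "open V" "f x \<in> V" "f -` V \<inter> topspace \<tau> \<subseteq> U"
        using sep[OF U x] by blast
      moreover have "x \<in> topspace \<tau>"
        using openin_subset[OF U] x by blast
      ultimately show "x \<in> \<Union>{S \<in> ?B. S \<subseteq> U}"
        by blast
    qed blast
    moreover have "generate_topology_on ?B (\<Union>{S \<in> ?B. S \<subseteq> U})"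
      by (rule generate_topology_on.UN) (blast intro: generate_topology_on.Basis)
    ultimately show "generate_topology_on ?B U"
      by simp
  qed
  then show ?thesis
    unfolding initial_topology_def topology_eq openin_topology_generated_by_iff by blast
qed

text \<open>Induction over the generation of open sets: those whose points are separated from the
  complement by a continuous function contain the subbasis and are stable under finite intersections
  and unions. The criterion \<open>completely_regular_space_alt'\<close> does not ask for values in
  \<open>[0, 1]\<close>, so no bounds have to be carried along.\<close>

lemma completely_regular_initial_topology:
  assumes \<tau>: "\<tau> = initial_topology (topspace \<tau>) \<F>"
    and cont: "\<And>f. f \<in> \<F> \<Longrightarrow> continuous_map \<tau> euclideanreal f"
  shows "completely_regular_space \<tau>"
proof -
  let ?B = "{f -` V \<inter> topspace \<tau> | f V. f \<in> \<F> \<and> open V}"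
  have gen: "openin \<tau> U \<longleftrightarrow> generate_topology_on ?B U" for U
    by (subst \<tau>) (simp add: initial_topology_def openin_topology_generated_by_iff)
  have "\<forall>x\<in>U. \<exists>h. continuous_map \<tau> euclideanreal h \<and> h x = 0 \<and> h ` (topspace \<tau> - U) \<subseteq> {1}"
    if "generate_topology_on ?B U" for U
    using that
  proof induction
    case (Int a b)
    show ?case
    proof
      fix x assume x: "x \<in> a \<inter> b"
      obtain f where f: "continuous_map \<tau> euclideanreal f" "f x = 0" "f ` (topspace \<tau> - a) \<subseteq> {1}"
        using Int.IH(1) x by blast
      obtain g where g: "continuous_map \<tau> euclideanreal g" "g x = 0" "g ` (topspace \<tau> - b) \<subseteq> {1}"
        using Int.IH(2) x by blast
      \<comment> \<open>Off \<open>a \<inter> b\<close> one of \<open>f\<close>, \<open>g\<close>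
        equals 1, so the product vanishes; at \<open>x\<close> both are 0, so the product is
        1.\<close>
      let ?h = "\<lambda>y. 1 - (1 - f y) * (1 - g y)"
      have "continuous_map \<tau> euclideanreal ?h"
        by (intro continuous_intros f g)
      moreover have "?h x = 0" "?h ` (topspace \<tau> - a \<inter> b) \<subseteq> {1}"
        using f g by auto
      ultimately show "\<exists>h. continuous_map \<tau> euclideanreal h \<and> h x = 0
          \<and> h ` (topspace \<tau> - a \<inter> b) \<subseteq> {1}"
        by blast
    qed
  next
    case (UN K)
    show ?case
    proof
      fix x assume "x \<in> \<Union>K"
      then obtain k where k: "k \<in> K" "x \<in> k" by blast
      then obtain h where "continuous_map \<tau> euclideanreal h" "h x = 0"
        "h ` (topspace \<tau> - k) \<subseteq> {1}"
        using UN.IH by blast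
      with k show "\<exists>h. continuous_map \<tau> euclideanreal h \<and> h x = 0
          \<and> h ` (topspace \<tau> - \<Union>K) \<subseteq> {1}"
        by blast
    qed
  next
    case (Basis S)
    then obtain f V where f: "f \<in> \<F>" and V: "open V" and S: "S = f -` V \<inter> topspace \<tau>"
      by blast
    show ?case
    proof
      fix x assume "x \<in> S"
      then have "f x \<in> V" using S by blast
      moreover have "completely_regular_space euclideanreal"
        by (simp add: metrizable_imp_completely_regular_space metrizable_space_euclidean)
      \<comment> \<open>The separation is carried out on the real line and pulled back along
        \<open>f\<close>.\<close>
      ultimately obtain g where g: "continuous_map euclideanreal euclideanreal g" "g (f x) = 0"
        "g ` (UNIV - V) \<subseteq> {1}"
        using V unfolding completely_regular_space_alt' by (metis open_openin topspace_euclidean)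
      have "continuous_map \<tau> euclideanreal (g \<circ> f)"
        using cont[OF f] g(1) continuous_map_compose by blast
      moreover have "(g \<circ> f) x = 0" "(g \<circ> f) ` (topspace \<tau> - S) \<subseteq> {1}"
        using g S by auto
      ultimately show "\<exists>h. continuous_map \<tau> euclideanreal h \<and> h x = 0
          \<and> h ` (topspace \<tau> - S) \<subseteq> {1}"
        by blast
    qed
  qed simp
  then show ?thesis
    unfolding completely_regular_space_alt' gen by blast
qed

subsection \<open>E.m.t. spaces and Tychonoff spaces\<close>

text \<open>Complete regularity comes from the initial topology. For the Hausdorff property, a
  nonzero distance is a nonzero supremum, so some function in \<open>LIPb1\<close> takes different
  values at the two points, and disjoint real neighbourhoods pull back.\<close>

lemma emt_space_imp_tychonoff_space:
  assumes "emt_space \<tau> d"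
  shows "tychonoff_space \<tau>"
proof -
  have dist: "extended_distance (topspace \<tau>) d"
    and \<tau>: "\<tau> = initial_topology (topspace \<tau>) (LIPb1 \<tau> d)"
    and sup: "\<And>x y. \<lbrakk>x \<in> topspace \<tau>; y \<in> topspace \<tau>\<rbrakk>
      \<Longrightarrow> d (x, y) = (SUP f\<in>LIPb1 \<tau> d. ennreal \<bar>f x - f y\<bar>)"
    using assms unfolding emt_space_def by blast+
  have cont: "continuous_map \<tau> euclideanreal f" if "f \<in> LIPb1 \<tau> d" for f
    using that by (simp add: LIPb1_def)
  have "Hausdorff_space \<tau>"
    unfolding Hausdorff_space_def
  proof (intro allI impI, elim conjE)
    fix x y assume x: "x \<in> topspace \<tau>" and y: "y \<in> topspace \<tau>" and "x \<noteq> y"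
    then have "d (x, y) \<noteq> 0"
      using dist unfolding extended_distance_def by blast
    then obtain f where f: "f \<in> LIPb1 \<tau> d" "f x \<noteq> f y"
      unfolding sup[OF x y] bot_ennreal[symmetric] SUP_bot_conv
      by (auto simp: bot_ennreal)
    obtain U V where UV: "open U" "open V" "f x \<in> U" "f y \<in> V" "U \<inter> V = {}"
      using hausdorff[OF f(2)] by blast
    show "\<exists>U V. openin \<tau> U \<and> openin \<tau> V \<and> x \<in> U \<and> y \<in> V \<and> disjnt U V"
    proof (intro exI conjI)
      show "openin \<tau> {z \<in> topspace \<tau>. f z \<in> U}" "openin \<tau> {z \<in> topspace \<tau>. f z \<in> V}"
        using openin_continuous_map_preimage[OF cont[OF f(1)]] UV by auto
    qed (use x y UV in \<open>auto simp: disjnt_def\<close>)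
  qed
  with completely_regular_initial_topology[OF \<tau> cont] show ?thesis
    by (simp add: tychonoff_space_def)
qed

lemma extended_distance_discrete:
  assumes "0 < l"
  shows "extended_distance X (discrete_distance l X)"
  using assms by (auto simp: extended_distance_def discrete_distance_def extensional_def)

text \<open>A function with values in \<open>[0, c]\<close> varies by at most
  \<open>c \<le> l\<close>, which is all that shortness for the discrete distance asks at distinct
  points. The height \<open>c\<close> is left free: one positive value recovers the topology, while
  values approaching \<open>l\<close> recover the distance.\<close>

lemma LIPb1_discrete_separating:
  assumes ty: "tychonoff_space \<tau>" and U: "openin \<tau> U" "x \<in> U"
    and c: "0 \<le> c" "ennreal c \<le> l"
  shows "\<exists>f\<in>LIPb1 \<tau> (discrete_distance l (topspace \<tau>)). f x = 0 \<and> (\<forall>y\<in>topspace \<tau> - U. f y = c)"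
proof -
  let ?X = "topspace \<tau>"
  have "closedin \<tau> (?X - U)" "x \<in> ?X - (?X - U)"
    using U openin_subset by auto
  then obtain g where g: "continuous_map \<tau> (top_of_set {0..1::real}) g" "g x = 0"
    "g ` (?X - U) \<subseteq> {1}"
    using ty unfolding tychonoff_space_def completely_regular_space_def by blast
  have g01: "0 \<le> g y \<and> g y \<le> 1" if "y \<in> ?X" for y
    using g(1) that by (force simp: continuous_map_in_subtopology)
  have gc: "continuous_map \<tau> euclideanreal g"
    using g(1) by (simp add: continuous_map_in_subtopology)
  define f where "f = (\<lambda>y\<in>?X. c * g y)"
  have f0c: "0 \<le> f y \<and> f y \<le> c" if "y \<in> ?X" for y
    using g01[OF that] c(1) that by (simp add: f_def mult_left_le)
  have "continuous_map \<tau> euclideanreal f"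
    using continuous_map_real_mult_left[OF gc, of c]
    by (rule continuous_map_eq) (simp add: f_def)
  moreover have "bounded (f ` ?X)"
    using f0c by (intro bounded_subset[OF bounded_closed_interval[of 0 c]]) auto
  moreover have "ennreal \<bar>f y - f z\<bar> \<le> discrete_distance l ?X (y, z)"
    if "y \<in> ?X" "z \<in> ?X" for y z
  proof -
    have "\<bar>f y - f z\<bar> \<le> c"
      using f0c[OF that(1)] f0c[OF that(2)] by linarith
    then have "ennreal \<bar>f y - f z\<bar> \<le> l"
      using c(2) ennreal_leI order_trans by blast
    then show ?thesis
      using that by (simp add: discrete_distance_def)
  qed
  ultimately have "f \<in> LIPb1 \<tau> (discrete_distance l ?X)"
    by (simp add: LIPb1_def f_def)
  moreover have "f x = 0" "\<forall>y\<in>?X - U. f y = c"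
    using g U openin_subset[OF U(1)] by (auto simp: f_def)
  ultimately show ?thesis
    by blast
qed

lemma emt_space_discrete:
  assumes l: "0 < l" and ty: "tychonoff_space \<tau>"
  shows "emt_space \<tau> (discrete_distance l (topspace \<tau>))"
proof -
  let ?X = "topspace \<tau>"
  let ?d = "discrete_distance l ?X"
  \<comment> \<open>Since \<open>l\<close> may be infinite, a finite positive height below it has to
    be chosen.\<close>
  obtain c where c: "0 < c" "ennreal c \<le> l"
  proof -
    obtain b where b: "0 < b" "b < l" using dense[OF l] by blast
    then have "b < top" using less_le_trans top_greatest by blast
    then have "0 < enn2real b" "ennreal (enn2real b) \<le> l"
      using b by (simp_all add: enn2real_positive_iff)
    then show ?thesis using that by blast
  qed
  have "initial_topology ?X (LIPb1 \<tau> ?d) = \<tau>"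
  proof (rule initial_topology_eqI)
    fix U x assume "openin \<tau> U" "x \<in> U"
    then obtain f where f: "f \<in> LIPb1 \<tau> ?d" "f x = 0" "\<forall>y\<in>?X - U. f y = c"
      using LIPb1_discrete_separating[OF ty _ _ less_imp_le[OF c(1)] c(2)] by blast
    show "\<exists>f\<in>LIPb1 \<tau> ?d. \<exists>V. open V \<and> f x \<in> V \<and> f -` V \<inter> ?X \<subseteq> U"
      \<comment> \<open>The ray \<open>{..<c}\<close> contains \<open>f x = 0\<close> but not the
        value \<open>c\<close> taken off \<open>U\<close>.\<close>
      by (intro bexI[OF _ f(1)] exI[of _ "{..<c}"]) (use f c in auto)
  qed (simp add: LIPb1_def)
  moreover have "?d (x, y) = (SUP f\<in>LIPb1 \<tau> ?d. ennreal \<bar>f x - f y\<bar>)"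
    if x: "x \<in> ?X" and y: "y \<in> ?X" for x y
  proof (rule antisym)
    show "(SUP f\<in>LIPb1 \<tau> ?d. ennreal \<bar>f x - f y\<bar>) \<le> ?d (x, y)"
      using x y by (intro SUP_least) (simp add: LIPb1_def)
    show "?d (x, y) \<le> (SUP f\<in>LIPb1 \<tau> ?d. ennreal \<bar>f x - f y\<bar>)"
    proof (cases "x = y")
      case True
      then show ?thesis using x by (simp add: discrete_distance_def)
    next
      case False
      have "l \<le> (SUP f\<in>LIPb1 \<tau> ?d. ennreal \<bar>f x - f y\<bar>)"
      \<comment> \<open>For infinite \<open>l\<close> no real function attains the distance, so each
        \<open>b < l\<close>, which is finite, is reached separately by a function of height
        \<open>b\<close> vanishing at \<open>x\<close>.\<close>
      proof (rule dense_le)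
        fix b assume b: "b < l"
        then have r: "b = ennreal (enn2real b)"
          by (metis ennreal_enn2real less_le_trans top_greatest)
        obtain U where U: "openin \<tau> U" "x \<in> U" "y \<notin> U"
          using ty x y False unfolding tychonoff_space_def Hausdorff_space_def disjnt_def by blast
        have "ennreal (enn2real b) \<le> l" using r b by simp
        then obtain f where f: "f \<in> LIPb1 \<tau> ?d" "f x = 0" "\<forall>y\<in>?X - U. f y = enn2real b"
          using LIPb1_discrete_separating[OF ty U(1,2) enn2real_nonneg] by blast
        have "b = ennreal \<bar>f x - f y\<bar>"
          using f U y r by simp
        then show "b \<le> (SUP f\<in>LIPb1 \<tau> ?d. ennreal \<bar>f x - f y\<bar>)"
          using SUP_upper[OF f(1)] by simp
      qed
      then show ?thesis using x y False by (simp add: discrete_distance_def)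
    qed
  qed
  ultimately show ?thesis
    using extended_distance_discrete[OF l] by (simp add: emt_space_def)
qed

subsection \<open>The categories and the functors\<close>

lemma Tych_simps:
  "\<tau> \<in> Obj Tych \<longleftrightarrow> tychonoff_space \<tau>"
  "f \<in> Hom Tych \<tau> \<tau>' \<longleftrightarrow> f \<in> extensional (topspace \<tau>) \<and> continuous_map \<tau> \<tau>' f"
  "Id Tych \<tau> = (\<lambda>x\<in>topspace \<tau>. x)"
  "Comp Tych \<tau> \<tau>' \<tau>'' g f = compose (topspace \<tau>) g f"
  by (simp_all add: Tych_def)

text \<open>One description covers both branches of \<open>ExtMetTop_le\<close>: for
  \<open>l = \<infinity>\<close> the bound holds trivially.\<close>

lemma ExtMetTop_le_simps:
  "(\<tau>, d) \<in> Obj (ExtMetTop_le l) \<longleftrightarrow>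
    emt_space \<tau> d \<and> (\<forall>x\<in>topspace \<tau>. \<forall>y\<in>topspace \<tau>. d (x, y) \<le> l)"
  "f \<in> Hom (ExtMetTop_le l) S T \<longleftrightarrow>
    f \<in> extensional (topspace (fst S)) \<and> continuous_short_map S T f"
  "Id (ExtMetTop_le l) S = (\<lambda>x\<in>topspace (fst S). x)"
  "Comp (ExtMetTop_le l) S T R g f = compose (topspace (fst S)) g f"
  by (auto simp: ExtMetTop_le_def ExtMetTop_def full_subcategory_def)

lemma continuous_map_compose_extensional:
  assumes "continuous_map \<tau> \<tau>' f" "continuous_map \<tau>' \<tau>'' g"
  shows "continuous_map \<tau> \<tau>'' (compose (topspace \<tau>) g f)"
  using continuous_map_compose[OF assms]
  by (rule continuous_map_eq) (simp add: compose_def)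

lemma continuous_map_restrict_id: "continuous_map \<tau> \<tau> (\<lambda>x\<in>topspace \<tau>. x)"
  using continuous_map_id[of \<tau>] by (rule continuous_map_eq) simp

lemma compose_assoc_continuous:
  assumes "continuous_map \<tau> \<tau>' f"
  shows "compose (topspace \<tau>) h (compose (topspace \<tau>) g f)
    = compose (topspace \<tau>) (compose (topspace \<tau>') h g) f"
  using assms by (intro compose_assoc) (simp add: continuous_map_def)

lemma category_Tych: "category Tych"
proof
  fix \<tau> \<tau>' :: "'a topology" and f assume f: "f \<in> Hom Tych \<tau> \<tau>'"
  then have "f \<in> topspace \<tau> \<rightarrow> topspace \<tau>'"
    by (simp add: Tych_simps continuous_map_def)
  with f show "Comp Tych \<tau> \<tau> \<tau>' f (Id Tych \<tau>) = f" "Comp Tych \<tau> \<tau>' \<tau>' (Id Tych \<tau>') f = f"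
    by (simp_all add: Tych_simps compose_Id Id_compose)
qed (auto simp: Tych_simps continuous_map_restrict_id compose_extensional
    intro: continuous_map_compose_extensional compose_assoc_continuous)

lemma continuous_short_map_compose:
  assumes "continuous_short_map S T f" "continuous_short_map T R g"
  shows "continuous_short_map S R (compose (topspace (fst S)) g f)"
proof -
  obtain \<tau> d \<tau>' d' \<tau>'' d'' where ST: "S = (\<tau>, d)" "T = (\<tau>', d')" "R = (\<tau>'', d'')"
    by (metis prod.exhaust)
  \<comment> \<open>Shortness of \<open>g\<close> is available only for points of the carrier of
    \<open>T\<close>.\<close>
  have "f x \<in> topspace \<tau>'" if "x \<in> topspace \<tau>" for x
    using assms that by (auto simp: ST continuous_short_map_def continuous_map_def)
  then show ?thesis
    using assms unfolding ST continuous_short_map_def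
    by (auto simp: continuous_map_compose_extensional compose_eq) (meson order_trans)
qed

lemma continuous_short_map_imp_continuous:
  "continuous_short_map S T f \<Longrightarrow> continuous_map (fst S) (fst T) f"
  by (auto simp: continuous_short_map_def split: prod.splits)

lemma category_ExtMetTop_le: "category (ExtMetTop_le l)"
proof
  fix S :: "'a emt"
  show "Id (ExtMetTop_le l) S \<in> Hom (ExtMetTop_le l) S S"
    by (cases S) (simp add: ExtMetTop_le_simps continuous_short_map_def continuous_map_restrict_id)
next
  fix S T :: "'a emt" and f assume f: "f \<in> Hom (ExtMetTop_le l) S T"
  then have "f \<in> topspace (fst S) \<rightarrow> topspace (fst T)"
    by (auto simp: ExtMetTop_le_simps continuous_map_def dest!: continuous_short_map_imp_continuous)
  with f show "Comp (ExtMetTop_le l) S S T f (Id (ExtMetTop_le l) S) = f"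
    "Comp (ExtMetTop_le l) S T T (Id (ExtMetTop_le l) T) f = f"
    by (simp_all add: ExtMetTop_le_simps compose_Id Id_compose)
qed (auto simp only: ExtMetTop_le_simps compose_extensional
    intro: continuous_short_map_compose
      compose_assoc_continuous[OF continuous_short_map_imp_continuous])

lemma discretisation_simps:
  "omap (discretisation l) \<tau> = (\<tau>, discrete_distance l (topspace \<tau>))"
  "amap (discretisation l) \<tau> \<tau>' f = f"
  by (simp_all add: discretisation_def)

lemma forgetful_simps: "omap forgetful S = fst S" "amap forgetful S T f = f"
  by (simp_all add: forgetful_def case_prod_beta)

lemma discretisation_in_Obj:
  assumes "0 < l" "\<tau> \<in> Obj Tych"
  shows "omap (discretisation l) \<tau> \<in> Obj (ExtMetTop_le l)"
  using assms emt_space_discrete[of l \<tau>]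
  by (simp add: Tych_simps ExtMetTop_le_simps discretisation_simps discrete_distance_def)

text \<open>Shortness out of a discrete space is automatic: at equal points because
  \<open>d' (z, z) = 0\<close>, at distinct points because the distances of \<open>Y\<close> are
  bounded by \<open>l\<close>.\<close>

lemma Hom_discretisation:
  assumes Y: "Y \<in> Obj (ExtMetTop_le l)"
  shows "Hom (ExtMetTop_le l) (omap (discretisation l) \<tau>) Y = Hom Tych \<tau> (omap forgetful Y)"
proof -
  obtain \<tau>' d' where [simp]: "Y = (\<tau>', d')" by (cases Y)
  have "extended_distance (topspace \<tau>') d'"
    using Y by (simp add: ExtMetTop_le_simps emt_space_def)
  then have "\<forall>x\<in>topspace \<tau>'. d' (x, x) = 0" "\<forall>x\<in>topspace \<tau>'. \<forall>y\<in>topspace \<tau>'. d' (x, y) \<le> l"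
    using Y by (simp_all add: ExtMetTop_le_simps extended_distance_def)
  then show ?thesis
    by (auto simp: ExtMetTop_le_simps Tych_simps discretisation_simps forgetful_simps
        continuous_short_map_def discrete_distance_def continuous_map_def Pi_iff)
qed

lemma is_functor_discretisation:
  assumes l: "0 < l"
  shows "is_functor Tych (ExtMetTop_le l) (discretisation l)"
proof -
  interpret A: category Tych by (rule category_Tych)
  interpret B: category "ExtMetTop_le l" by (rule category_ExtMetTop_le)
  show ?thesis
  proof
    fix \<tau> \<tau>' :: "'a topology" and f assume "\<tau>' \<in> Obj Tych" and f: "f \<in> Hom Tych \<tau> \<tau>'"
    then show "amap (discretisation l) \<tau> \<tau>' f \<in>
        Hom (ExtMetTop_le l) (omap (discretisation l) \<tau>) (omap (discretisation l) \<tau>')"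
      \<comment> \<open>Two passes: unfolding the functor at once would destroy the pattern that
        \<open>Hom_discretisation\<close> matches.\<close>
      by (simp add: Hom_discretisation[OF discretisation_in_Obj[OF l]])
         (simp add: discretisation_simps forgetful_simps)
  qed (use discretisation_in_Obj[OF l] in
      \<open>auto simp: discretisation_simps Tych_simps ExtMetTop_le_simps\<close>)
qed

text \<open>Forgetting the distance undoes the discretisation, so \<open>Hom_discretisation\<close>
  with a discretised target equates the two hom-sets, and the action on morphisms is the identity
  between them.\<close>

lemma fully_faithful_discretisation:
  assumes l: "0 < l"
  shows "fully_faithful Tych (ExtMetTop_le l) (discretisation l)"
  unfolding fully_faithful_def
  by (simp add: is_functor_discretisation[OF l] Hom_discretisation[OF discretisation_in_Obj[OF l]])
     (simp add: discretisation_simps forgetful_simps bij_betw_def inj_on_def)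

lemma is_functor_forgetful: "is_functor (ExtMetTop_le l) Tych forgetful"
proof -
  interpret A: category "ExtMetTop_le l" by (rule category_ExtMetTop_le)
  interpret B: category Tych by (rule category_Tych)
  show ?thesis
    by unfold_locales (auto simp: forgetful_simps Tych_simps ExtMetTop_le_simps
        emt_space_imp_tychonoff_space continuous_short_map_imp_continuous
        dest: continuous_short_map_imp_continuous)
qed

lemma left_adjoint_discretisation_forgetful:
  assumes l: "0 < l"
  shows "left_adjoint Tych (ExtMetTop_le l) (discretisation l) forgetful"
  unfolding left_adjoint_def
\<comment> \<open>The hom-sets coincide, so the identity serves as the bijection; both sides of
  naturality then unfold to the same nested \<open>compose\<close> over the carrier of
  \<open>X'\<close>.\<close>
proof (intro conjI exI[of _ "\<lambda>_ _ h. h"] ballI)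
  show "bij_betw (\<lambda>h. h) (Hom (ExtMetTop_le l) (omap (discretisation l) \<tau>) Y)
      (Hom Tych \<tau> (omap forgetful Y))"
    if "Y \<in> Obj (ExtMetTop_le l)" for \<tau> :: "'a topology" and Y
    using Hom_discretisation[OF that] by (simp add: bij_betw_def)
qed (simp_all add: is_functor_discretisation[OF l] is_functor_forgetful
    Tych_simps ExtMetTop_le_simps discretisation_simps forgetful_simps)

theorem theorem3p21:
  fixes l :: ennreal
  assumes "0 < l"
  shows "is_functor (Tych :: ('a topology, 'a \<Rightarrow> 'a) cat) (ExtMetTop_le l) (discretisation l)
    \<and> fully_faithful (Tych :: ('a topology, 'a \<Rightarrow> 'a) cat) (ExtMetTop_le l) (discretisation l)
    \<and> injective_on_objects (Tych :: ('a topology, 'a \<Rightarrow> 'a) cat)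
        (discretisation l :: ('a topology, 'a \<Rightarrow> 'a, 'a emt, 'a \<Rightarrow> 'a) func)
    \<and> is_functor (ExtMetTop_le l) (Tych :: ('a topology, 'a \<Rightarrow> 'a) cat) forgetful
    \<and> left_adjoint (Tych :: ('a topology, 'a \<Rightarrow> 'a) cat) (ExtMetTop_le l) (discretisation l) forgetful
    \<and> exhibits_coreflective (Tych :: ('a topology, 'a \<Rightarrow> 'a) cat) (ExtMetTop_le l)
        (discretisation l) forgetful"
  \<comment> \<open>Injectivity on objects holds because the topology is the first component of its
    image.\<close>
  using is_functor_discretisation[OF assms] fully_faithful_discretisation[OF assms]
    is_functor_forgetful left_adjoint_discretisation_forgetful[OF assms]
  by (auto simp: exhibits_coreflective_def injective_on_objects_def inj_on_def
      discretisation_simps)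

end
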